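(* (Provable in ZFC, with no additional set-theoretic hypotheses.) There exist a concept class $\mathcal{C}$ on the interval $[0,1]$, all of whose members are Borel subsets of $[0,1]$, with VC dimension $\operatorname{VCdim}(\mathcal{C})=1$, and a consistent learning rule $L=(L_n)_{n\ge 1}$ for $\mathcal{C}$ such that $L$ is not PAC for $\mathcal{C}$.
   Context: Let $X$ be a Polish space (here $X=[0,1]$ with its usual topology). A concept is a subset of $X$, and a concept class $\mathcal{C}$ on $X$ is a collection of concepts. The class is Borel if every member is a Borel set. VC dimension: for a finite set $F\subseteq X$, the trace of $\mathcal{C}$ on $F$ is $\{H\cap F: H\in\mathcal{C}\}$; $F$ is shattered by $\mathcal{C}$ if its trace equals the power set $\mathcal{P}(F)$. Then $\operatorname{VCdim}(\mathcal{C})=\sup\{|F|: F\subseteq X \text{ finite and shattered by } \mathcal{C}\}$. Labeled samples: write $\mathbf{1}_A$ for the characteristic function of $A\subseteq X$. For $C\in\mathcal{C}$ and $s=(x_1,\dots,x_n)\in X^n$, put $S_C(s)=((x_1,\mathbf{1}_C(x_1)),\dots,(x_n,\mathbf{1}_C(x_n)))\in (X\times\{0,1\})^n$. Learning rule: a learning rule for $\mathcal{C}$ is a sequence $L=(L_n)_{n\ge1}$ of arbitrary maps $L_n:(X\times\{0,1\})^n\to\mathcal{C}$ (so all learning rules are proper). It is consistent if for every $C\in\mathcal{C}$, every $n\ge1$ and every $s=(x_1,\dots,x_n)\in X^n$, one has $x_i\in L_n(S_C(s))\iff x_i\in C$ for all $i=1,\dots,n$. True risk: for a Borel concept class $\mathcal{C}$,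 a target $C\in\mathcal{C}$, a Borel probability measure $\mu$ on $X$, and $n\ge1$, let $r_{C,\mu,n}:X^n\to[0,1]$, $r_{C,\mu,n}(s)=\mu(L_n(S_C(s))\mathbin{\triangle} C)$, where $\triangle$ is symmetric difference. For $\varepsilon>0$ let $B_{C,\mu,n}(\varepsilon)=\{s\in X^n: r_{C,\mu,n}(s)>\varepsilon\}$. PAC: let $\mu^{\otimes n}$ be the product measure on the Borel sets of $X^n$ and $(\mu^{\otimes n})^*$ the induced outer measure. The rule $L$ is PAC for $\mathcal{C}$ if for every $\varepsilon,\delta>0$ there exists $N\ge1$ such that for every $n\ge N$, every $C\in\mathcal{C}$ and every Borel probability measure $\mu$ on $X$, $(\mu^{\otimes n})^*(B_{C,\mu,n}(\varepsilon))\le\delta$. *)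

theory Defs
  imports "HOL-Probability.Probability"
begin

text \<open>
  The ambient space is a subset \<open>X\<close> of a topological space with its subspace topology, so its
  Borel \<open>\<sigma>\<close>-algebra is that of \<^term>\<open>restrict_space borel X\<close>.  A point of \<open>X\<^sup>n\<close> is an element of
  \<^term>\<open>{..<n} \<rightarrow>\<^sub>E X\<close> (coordinates \<open>0, \<dots>, n - 1\<close>), and labels are of type \<^typ>\<open>bool\<close>, with
  \<^term>\<open>True\<close> for 1 and \<^term>\<open>False\<close> for 0.
\<close>

definition concept_class :: "'a set \<Rightarrow> 'a set set \<Rightarrow> bool" where
  "concept_class X \<C> \<longleftrightarrow> \<C> \<subseteq> Pow X"

definition borel_concept_class :: "'a::topological_space set \<Rightarrow> 'a set set \<Rightarrow> bool" where
  "borel_concept_class X \<C> \<longleftrightarrow>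
     concept_class X \<C> \<and> (\<forall>C\<in>\<C>. C \<in> sets (restrict_space borel X))"

definition trace_on :: "'a set set \<Rightarrow> 'a set \<Rightarrow> 'a set set" where
  "trace_on \<C> F = {H \<inter> F | H. H \<in> \<C>}"

definition shattered_by :: "'a set set \<Rightarrow> 'a set \<Rightarrow> bool" where
  "shattered_by \<C> F \<longleftrightarrow> trace_on \<C> F = Pow F"

definition VCdim :: "'a set \<Rightarrow> 'a set set \<Rightarrow> enat" where
  "VCdim X \<C> = (SUP F \<in> {F. finite F \<and> F \<subseteq> X \<and> shattered_by \<C> F}. enat (card F))"

definition labeled_sample :: "nat \<Rightarrow> 'a set \<Rightarrow> (nat \<Rightarrow> 'a) \<Rightarrow> nat \<Rightarrow> 'a \<times> bool" where
  "labeled_sample n C s = (\<lambda>i\<in>{..<n}. (s i, s i \<in> C))"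

text \<open>A learning rule is indexed by \<open>n \<ge> 1\<close>; the value at index 0 is left unconstrained.\<close>

definition learning_rule ::
    "'a set \<Rightarrow> 'a set set \<Rightarrow> (nat \<Rightarrow> (nat \<Rightarrow> 'a \<times> bool) \<Rightarrow> 'a set) \<Rightarrow> bool" where
  "learning_rule X \<C> L \<longleftrightarrow> (\<forall>n\<ge>1. L n \<in> ({..<n} \<rightarrow>\<^sub>E X \<times> (UNIV :: bool set)) \<rightarrow> \<C>)"

definition consistent_rule ::
    "'a set \<Rightarrow> 'a set set \<Rightarrow> (nat \<Rightarrow> (nat \<Rightarrow> 'a \<times> bool) \<Rightarrow> 'a set) \<Rightarrow> bool" where
  "consistent_rule X \<C> L \<longleftrightarrow>
     (\<forall>C\<in>\<C>. \<forall>n\<ge>1. \<forall>s \<in> {..<n} \<rightarrow>\<^sub>E X. \<forall>i<n.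
        s i \<in> L n (labeled_sample n C s) \<longleftrightarrow> s i \<in> C)"

definition borel_prob_measure :: "'a::topological_space set \<Rightarrow> 'a measure \<Rightarrow> bool" where
  "borel_prob_measure X \<mu> \<longleftrightarrow> prob_space \<mu> \<and> sets \<mu> = sets (restrict_space borel X)"

definition true_risk ::
    "(nat \<Rightarrow> (nat \<Rightarrow> 'a \<times> bool) \<Rightarrow> 'a set) \<Rightarrow> 'a set \<Rightarrow> 'a measure \<Rightarrow> nat \<Rightarrow> (nat \<Rightarrow> 'a) \<Rightarrow> real" where
  "true_risk L C \<mu> n s = measure \<mu> (sym_diff (L n (labeled_sample n C s)) C)"

definition bad_samples ::
    "'a set \<Rightarrow> (nat \<Rightarrow> (nat \<Rightarrow> 'a \<times> bool) \<Rightarrow> 'a set) \<Rightarrow> 'a set \<Rightarrow> 'a measure \<Rightarrow> nat \<Rightarrow> real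
       \<Rightarrow> (nat \<Rightarrow> 'a) set" where
  "bad_samples X L C \<mu> n \<epsilon> = {s \<in> {..<n} \<rightarrow>\<^sub>E X. true_risk L C \<mu> n s > \<epsilon>}"

text \<open>
  For second countable \<open>X\<close> the product \<open>\<sigma>\<close>-algebra underlying \<^term>\<open>Pi\<^sub>M {..<n} (\<lambda>_. \<mu>)\<close> is the
  Borel \<open>\<sigma>\<close>-algebra of \<open>X\<^sup>n\<close>.  The bad set need not be measurable, whence the outer measure.
\<close>

definition PAC_rule ::
    "'a::topological_space set \<Rightarrow> 'a set set \<Rightarrow> (nat \<Rightarrow> (nat \<Rightarrow> 'a \<times> bool) \<Rightarrow> 'a set) \<Rightarrow> bool" where
  "PAC_rule X \<C> L \<longleftrightarrow>
     (\<forall>\<epsilon>>0. \<forall>\<delta>>0. \<exists>N\<ge>1. \<forall>n\<ge>N. \<forall>C\<in>\<C>. \<forall>\<mu>. borel_prob_measure X \<mu> \<longrightarrow>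
        outer_measure_of (Pi\<^sub>M {..<n} (\<lambda>_. \<mu>)) (bad_samples X L C \<mu> n \<epsilon>) \<le> ennreal \<delta>)"

end

theory Submission
  imports Defs
begin

text \<open>
  Every probability measure on the interval without atoms admits a chain, under inclusion, of
  Borel null sets whose union \<open>M\<close> is not contained in a null set: any inclusion-maximal chain
  \<open>\<K>\<close> of null sets is of this kind, because a null set covering the union could be enlarged by
  a single point and then added to the chain (\<open>maxchain_null_sets_union\<close>).

  The concept class is \<open>\<K>\<close> together with the whole interval.  It is a chain of sets, so its VC
  dimension is 1.  The learning rule answers with a member of \<open>\<K>\<close> whenever one fits the sample,
  and with the whole interval otherwise; this is consistent.  If the target is the whole interval,
  all labels are 1, and a sample drawn from \<open>M\<close> lies in a single member of \<open>\<K>\<close>, since \<open>\<K>\<close> is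
  a chain and the sample is finite.  The answer is then a null set and the risk is 1.  All
  samples in \<open>M\<^sup>n\<close> are therefore bad.

  The set \<open>M\<^sup>n\<close> must not become negligible as \<open>n\<close> grows.  This is arranged by conditioning
  Lebesgue measure on a measurable envelope of \<open>M\<close>: for the conditioned measure \<open>\<mu>\<close> the set \<open>M\<close>
  has outer measure 1 (\<open>outer_measure_of_uniform_measure_envelope\<close>), and then so does \<open>M\<^sup>n\<close>
  for \<open>\<mu>\<^sup>n\<close>, by Fubini's theorem (\<open>outer_measure_of_PiE_eq_1\<close>).
\<close>

section \<open>A chain of null sets with a non-null union\<close>

text \<open>
  A null set \<open>B\<close> covering \<open>\<Union>\<K>\<close> misses some point \<open>x\<close> of the space.  Then \<open>insert x B\<close> is null and
  contains every member of \<open>\<K>\<close>, so by maximality it belongs to \<open>\<K>\<close>, which puts \<open>x\<close> into \<open>B\<close>.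
\<close>

lemma maxchain_null_sets_union:
  assumes max: "subset.maxchain (null_sets M) \<K>"
    and points: "\<And>x. x \<in> space M \<Longrightarrow> {x} \<in> null_sets M"
    and space: "space M \<notin> null_sets M"
    and B: "B \<in> null_sets M"
  shows "\<not> \<Union>\<K> \<subseteq> B"
proof
  assume cover: "\<Union>\<K> \<subseteq> B"
  have "B \<subseteq> space M"
    using B sets.sets_into_space by blast
  then obtain x where x: "x \<in> space M" "x \<notin> B"
    using B space by (metis subsetI subset_antisym)
  have "insert x B \<in> null_sets M"
    using null_sets.Un[OF points[OF x(1)] B] by simp
  moreover have "\<forall>K\<in>\<K>. K \<subset> insert x B \<or> K = insert x B"
    using cover by auto
  ultimately have "subset.chain (null_sets M) ({insert x B} \<union> \<K>)"
    using subset.chain_extend[OF subset.maxchain_imp_chain[OF max]] by auto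
  then have "insert x B \<in> \<K>"
    using max unfolding subset.maxchain_def by auto
  then show False
    using cover x by blast
qed

section \<open>Sets of full outer measure\<close>

lemma outer_measure_of_eq_1D:
  assumes "prob_space M" "outer_measure_of M S = 1" "B \<in> sets M" "S \<subseteq> B"
  shows "emeasure M B = 1"
proof -
  have "1 \<le> emeasure M B"
    using outer_measure_of_mono[OF assms(4), of M] assms(2,3) by simp
  then show ?thesis
    using prob_space.emeasure_le_1[OF assms(1)] by (intro antisym) auto
qed

text \<open>
  If a measurable \<open>B\<close> covers \<open>S\<close>, then so does \<open>E \<inter> B\<close>, whose measure is therefore not below the
  outer measure of \<open>S\<close>, which is that of \<open>E\<close>.  Hence \<open>B\<close> has conditional measure 1 given \<open>E\<close>.
\<close>

lemma outer_measure_of_uniform_measure_envelope: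
  assumes E: "E \<in> sets M" "S \<subseteq> E" "outer_measure_of M S = emeasure M E"
    and pos: "emeasure M E \<noteq> 0" and fin: "emeasure M E \<noteq> \<infinity>"
  shows "outer_measure_of (uniform_measure M E) S = 1"
proof -
  have one: "emeasure (uniform_measure M E) B = 1" if B: "B \<in> sets M" "S \<subseteq> B" for B
  proof -
    have "emeasure M E \<le> emeasure M (E \<inter> B)"
      using outer_measure_of_mono[of S "E \<inter> B" M] E B by simp
    moreover have "emeasure M (E \<inter> B) \<le> emeasure M E"
      using E(1) by (intro emeasure_mono) auto
    ultimately have "emeasure M (E \<inter> B) = emeasure M E"
      by (rule antisym[rotated])
    then show ?thesis
      using E(1) B(1) pos fin by (simp add: ennreal_divide_self top.not_eq_extremum)
  qed
  have "(INF B\<in>{B \<in> sets M. S \<subseteq> B}. emeasure (uniform_measure M E) B) = 1"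
    using E(1,2) one by (intro INF_eq_const) auto
  then show ?thesis
    unfolding outer_measure_of_def by simp
qed

text \<open>
  Induction on the index set.  For a measurable \<open>A\<close> containing the power of \<open>S\<close>, the section of
  \<open>A\<close> at \<open>y \<in> S\<close> contains the smaller power of \<open>S\<close>, so it has measure 1.  The set of all \<open>y\<close> whose
  section has measure 1 is measurable and contains \<open>S\<close>, so it has full measure, and Fubini's
  theorem gives \<open>A\<close> measure 1.
\<close>

lemma emeasure_PiM_eq_1_if_PiE_subset:
  assumes M: "prob_space M" and S: "S \<subseteq> space M" "outer_measure_of M S = 1"
  assumes "finite I" "A \<in> sets (Pi\<^sub>M I (\<lambda>_. M))" "(\<Pi>\<^sub>E i\<in>I. S) \<subseteq> A"
  shows "emeasure (Pi\<^sub>M I (\<lambda>_. M)) A = 1"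
  using assms(4-)
proof (induction I arbitrary: A rule: finite_induct)
  case empty
  interpret P: prob_space "Pi\<^sub>M {} (\<lambda>_::'b. M)"
    using M by (intro prob_space_PiM)
  have "A = space (Pi\<^sub>M {} (\<lambda>_::'b. M))"
    using empty sets.sets_into_space[OF empty(1)] by (auto simp: space_PiM)
  then show ?case
    using P.emeasure_space_1 by simp
next
  case (insert i I)
  interpret prob_space M by fact
  interpret product_sigma_finite "\<lambda>_. M" ..
  interpret P: prob_space "Pi\<^sub>M I (\<lambda>_. M)"
    using M by (intro prob_space_PiM)
  define sec where "sec y = {x \<in> space (Pi\<^sub>M I (\<lambda>_. M)). x(i := y) \<in> A}" for y
  define g where "g y = (\<integral>\<^sup>+ x. indicator A (x(i := y)) \<partial>Pi\<^sub>M I (\<lambda>_. M))" for y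
  have upd: "(\<lambda>p. (snd p)(i := fst p)) \<in> M \<Otimes>\<^sub>M Pi\<^sub>M I (\<lambda>_. M) \<rightarrow>\<^sub>M Pi\<^sub>M (insert i I) (\<lambda>_. M)"
    by (rule measurable_fun_upd[of _ I]) auto
  have [measurable]: "g \<in> borel_measurable M"
    unfolding g_def
    using measurable_compose[OF upd borel_measurable_indicator[OF insert.prems(1)]]
    by (intro P.borel_measurable_nn_integral) (simp add: case_prod_beta')
  have g_sec: "g y = emeasure (Pi\<^sub>M I (\<lambda>_. M)) (sec y)" and sec: "sec y \<in> sets (Pi\<^sub>M I (\<lambda>_. M))"
    if y: "y \<in> space M" for y
  proof -
    have "(\<lambda>x. x(i := y)) \<in> Pi\<^sub>M I (\<lambda>_. M) \<rightarrow>\<^sub>M Pi\<^sub>M (insert i I) (\<lambda>_. M)"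
      using measurable_compose[OF measurable_Pair1'[OF y] upd] by simp
    from measurable_sets[OF this insert.prems(1)]
    show s: "sec y \<in> sets (Pi\<^sub>M I (\<lambda>_. M))"
      by (simp add: sec_def vimage_def Int_def conj_commute)
    have "g y = (\<integral>\<^sup>+ x. indicator (sec y) x \<partial>Pi\<^sub>M I (\<lambda>_. M))"
      unfolding g_def by (intro nn_integral_cong) (auto simp: sec_def indicator_def)
    then show "g y = emeasure (Pi\<^sub>M I (\<lambda>_. M)) (sec y)"
      using s by simp
  qed
  have "g y = 1" if "y \<in> S" for y
  proof -
    have "x \<in> sec y" if x: "x \<in> (\<Pi>\<^sub>E i\<in>I. S)" for x
    proof -
      have "x(i := y) \<in> A"
        using PiE_fun_upd[OF \<open>y \<in> S\<close> x] insert.prems(2) by blast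
      moreover have "x \<in> space (Pi\<^sub>M I (\<lambda>_. M))"
        using x S(1) by (auto simp: space_PiM PiE_iff)
      ultimately show ?thesis
        by (simp add: sec_def)
    qed
    then have "(\<Pi>\<^sub>E i\<in>I. S) \<subseteq> sec y"
      by blast
    moreover have "y \<in> space M"
      using S(1) that by blast
    ultimately show ?thesis
      using insert.IH[OF sec] g_sec by simp
  qed
  then have "emeasure M {y \<in> space M. g y = 1} = 1"
    using S by (intro outer_measure_of_eq_1D[OF M S(2)]) auto
  then have "AE y in M. g y = 1"
    using AE_iff_emeasure_eq_1[of "\<lambda>y. g y = 1"] by simp
  then have "(\<integral>\<^sup>+ y. g y \<partial>M) = (\<integral>\<^sup>+ y. 1 \<partial>M)"
    by (rule nn_integral_cong_AE)
  then have "(\<integral>\<^sup>+ y. g y \<partial>M) = 1"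
    by (simp add: emeasure_space_1)
  then show ?case
    using product_nn_integral_insert_rev[OF insert.hyps borel_measurable_indicator[OF insert.prems(1)]]
      insert.prems(1)
    by (simp add: g_def)
qed

lemma outer_measure_of_PiE_eq_1:
  assumes M: "prob_space M" and S: "S \<subseteq> space M" "outer_measure_of M S = 1" and I: "finite I"
  shows "outer_measure_of (Pi\<^sub>M I (\<lambda>_. M)) (\<Pi>\<^sub>E i\<in>I. S) = 1"
proof -
  have "(\<Pi>\<^sub>E i\<in>I. S) \<subseteq> space (Pi\<^sub>M I (\<lambda>_. M))"
    using S(1) by (auto simp: space_PiM PiE_iff)
  then show ?thesis
    unfolding outer_measure_of_def
    using emeasure_PiM_eq_1_if_PiE_subset[OF M S I] by (intro INF_eq_const) auto
qed

section \<open>Classes that are chains\<close>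

text \<open>
  Shattering a two-point set \<open>{x, y}\<close> needs one concept containing only \<open>x\<close> and one containing
  only \<open>y\<close>; two such concepts are incomparable.
\<close>

lemma VCdim_chain_eq_1:
  assumes chain: "\<And>H K. H \<in> \<C> \<Longrightarrow> K \<in> \<C> \<Longrightarrow> H \<subseteq> K \<or> K \<subseteq> H"
    and witness: "H \<in> \<C>" "K \<in> \<C>" "x \<in> X" "x \<in> H" "x \<notin> K"
  shows "VCdim X \<C> = 1"
proof (rule antisym)
  show "VCdim X \<C> \<le> 1"
    unfolding VCdim_def
  proof (rule SUP_least)
    fix F assume F: "F \<in> {F. finite F \<and> F \<subseteq> X \<and> shattered_by \<C> F}"
    have "x = y" if xy: "x \<in> F" "y \<in> F" for x y
    proof (rule ccontr)
      assume "x \<noteq> y"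
      have trace: "\<exists>H\<in>\<C>. H \<inter> F = {z}" if "z \<in> F" for z
      proof -
        have "{z} \<in> trace_on \<C> F"
          using F that by (simp add: shattered_by_def)
        then show ?thesis
          by (auto simp: trace_on_def)
      qed
      obtain Hx Hy where H: "Hx \<in> \<C>" "Hx \<inter> F = {x}" "Hy \<in> \<C>" "Hy \<inter> F = {y}"
        using trace[OF xy(1)] trace[OF xy(2)] by metis
      have "x \<in> Hx" "y \<notin> Hx" "x \<notin> Hy" "y \<in> Hy"
        using H(2,4) xy \<open>x \<noteq> y\<close> by auto
      then show False
        using chain[OF H(1,3)] by auto
    qed
    then have "card F \<le> 1"
      using F by (simp add: card_le_Suc0_iff_eq)
    then show "enat (card F) \<le> 1"
      by (simp add: one_enat_def)
  qed
  have "trace_on \<C> {x} = Pow {x}"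
  proof
    show "Pow {x} \<subseteq> trace_on \<C> {x}"
    proof
      fix T assume "T \<in> Pow {x}"
      then have "T = {x} \<or> T = {}"
        by auto
      then have "T = H \<inter> {x} \<or> T = K \<inter> {x}"
        using witness(4,5) by auto
      then show "T \<in> trace_on \<C> {x}"
        using witness(1,2) by (auto simp: trace_on_def)
    qed
  qed (auto simp: trace_on_def)
  then have "enat (card {x}) \<le> VCdim X \<C>"
    unfolding VCdim_def using witness(3) by (intro SUP_upper) (simp add: shattered_by_def)
  then show "1 \<le> VCdim X \<C>"
    by (simp add: one_enat_def)
qed

section \<open>The rule that prefers small concepts\<close>

definition fits :: "nat \<Rightarrow> (nat \<Rightarrow> 'a \<times> bool) \<Rightarrow> 'a set \<Rightarrow> bool" where
  "fits n \<sigma> H \<longleftrightarrow> (\<forall>i<n. fst (\<sigma> i) \<in> H \<longleftrightarrow> snd (\<sigma> i))"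

definition prefer_rule :: "'a set set \<Rightarrow> 'a set \<Rightarrow> nat \<Rightarrow> (nat \<Rightarrow> 'a \<times> bool) \<Rightarrow> 'a set" where
  "prefer_rule \<K> X n \<sigma> =
     (if \<exists>K\<in>\<K>. fits n \<sigma> K then SOME K. K \<in> \<K> \<and> fits n \<sigma> K else X)"

lemma fits_labeled_sample:
  "fits n (labeled_sample n C s) H \<longleftrightarrow> (\<forall>i<n. s i \<in> H \<longleftrightarrow> s i \<in> C)"
  by (simp add: fits_def labeled_sample_def)

lemma prefer_rule_fits:
  assumes "\<exists>K\<in>\<K>. fits n \<sigma> K"
  shows "prefer_rule \<K> X n \<sigma> \<in> \<K>" "fits n \<sigma> (prefer_rule \<K> X n \<sigma>)"
  using someI_ex[of "\<lambda>K. K \<in> \<K> \<and> fits n \<sigma> K"] assms by (auto simp: prefer_rule_def)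

lemma learning_rule_prefer_rule: "learning_rule X (insert X \<K>) (prefer_rule \<K> X)"
proof -
  have "prefer_rule \<K> X n \<sigma> \<in> insert X \<K>" for n \<sigma>
    using prefer_rule_fits(1)[of \<K> n \<sigma> X] by (auto simp: prefer_rule_def)
  then show ?thesis
    by (auto simp: learning_rule_def)
qed

lemma consistent_rule_prefer_rule: "consistent_rule X (insert X \<K>) (prefer_rule \<K> X)"
  unfolding consistent_rule_def
proof (intro ballI allI impI)
  fix C s and n i :: nat
  assume C: "C \<in> insert X \<K>" and i: "i < n"
  let ?\<sigma> = "labeled_sample n C s"
  have "fits n ?\<sigma> C"
    by (simp add: fits_labeled_sample)
  then have "fits n ?\<sigma> (prefer_rule \<K> X n ?\<sigma>)"
    using C prefer_rule_fits(2)[of \<K> n ?\<sigma> X]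
    by (cases "\<exists>K\<in>\<K>. fits n ?\<sigma> K") (auto simp: prefer_rule_def)
  then show "s i \<in> prefer_rule \<K> X n ?\<sigma> \<longleftrightarrow> s i \<in> C"
    using i by (simp add: fits_labeled_sample)
qed

text \<open>
  Against the target \<open>X\<close>, a sample from the union of a chain of null sets is contained in one
  member of the chain, so the rule answers with a null set, at distance 1 from \<open>X\<close>.
\<close>

lemma not_PAC_prefer_rule:
  assumes \<mu>: "borel_prob_measure X \<mu>"
    and chain: "subset.chain (null_sets \<mu>) \<K>"
    and full: "outer_measure_of \<mu> (\<Union>\<K>) = 1"
  shows "\<not> PAC_rule X (insert X \<K>) (prefer_rule \<K> X)"
proof
  let ?L = "prefer_rule \<K> X"
  interpret prob_space \<mu>
    using \<mu> by (simp add: borel_prob_measure_def)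
  have space: "space \<mu> = X"
    using \<mu> sets_eq_imp_space_eq[of \<mu> "restrict_space borel X"]
    by (simp add: borel_prob_measure_def space_restrict_space)
  have null: "K \<in> null_sets \<mu>" if "K \<in> \<K>" for K
    using chain that by (auto simp: subset.chain_def)
  have sub: "\<Union>\<K> \<subseteq> X"
    using null sets.sets_into_space space by blast
  have bad: "(\<Pi>\<^sub>E i\<in>{..<n}. \<Union>\<K>) \<subseteq> bad_samples X ?L X \<mu> n (1/2)" for n
  proof
    fix s assume s: "s \<in> (\<Pi>\<^sub>E i\<in>{..<n}. \<Union>\<K>)"
    let ?\<sigma> = "labeled_sample n X s"
    have "\<K> \<noteq> {}"
      using full by auto
    moreover have "s ` {..<n} \<subseteq> \<Union>\<K>"
      using s by (auto simp: PiE_iff)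
    ultimately obtain K where K: "K \<in> \<K>" "s ` {..<n} \<subseteq> K"
      using finite_subset_Union_chain[OF _ _ _ chain, of "s ` {..<n}"] by blast
    then have "fits n ?\<sigma> K"
      using s sub by (auto simp: fits_labeled_sample PiE_iff)
    then have "?L n ?\<sigma> \<in> null_sets \<mu>"
      using K(1) prefer_rule_fits(1) null by blast
    moreover from this have "?L n ?\<sigma> \<subseteq> X"
      using sets.sets_into_space space by blast
    ultimately have "sym_diff (?L n ?\<sigma>) X = space \<mu> - ?L n ?\<sigma>"
      and "prob (space \<mu> - ?L n ?\<sigma>) = 1"
      using space prob_compl[of "?L n ?\<sigma>"] by (auto simp: measure_eq_0_null_sets)
    then have "true_risk ?L X \<mu> n s = 1"
      by (simp add: true_risk_def)
    then show "s \<in> bad_samples X ?L X \<mu> n (1/2)"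
      using s sub by (auto simp: bad_samples_def PiE_iff)
  qed
  assume "PAC_rule X (insert X \<K>) ?L"
  then obtain n where
    n: "outer_measure_of (Pi\<^sub>M {..<n} (\<lambda>_. \<mu>)) (bad_samples X ?L X \<mu> n (1/2)) \<le> ennreal (1/2)"
    using \<mu> unfolding PAC_rule_def by (meson half_gt_zero zero_less_one insertI1 order_refl)
  have "1 = outer_measure_of (Pi\<^sub>M {..<n} (\<lambda>_. \<mu>)) (\<Pi>\<^sub>E i\<in>{..<n}. \<Union>\<K>)"
    using outer_measure_of_PiE_eq_1[OF prob_space_axioms _ full, of "{..<n}"] sub space by simp
  also have "\<dots> \<le> ennreal (1/2)"
    using outer_measure_of_mono[OF bad] n by (rule order_trans)
  finally have "ennreal 1 \<le> ennreal (1/2)"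
    by simp
  then show False
    by (subst (asm) ennreal_le_iff) simp_all
qed

section \<open>The class on the unit interval\<close>

theorem theorem1p1:
  shows "\<exists>(\<C> :: real set set) (L :: nat \<Rightarrow> (nat \<Rightarrow> real \<times> bool) \<Rightarrow> real set).
    borel_concept_class {0..1} \<C> \<and> VCdim {0..1} \<C> = 1 \<and>
    learning_rule {0..1} \<C> L \<and> consistent_rule {0..1} \<C> L \<and> \<not> PAC_rule {0..1} \<C> L"
proof -
  let ?X = "{0..1} :: real set"
  let ?lam = "restrict_space lborel ?X"
  have sets_lam: "sets ?lam = sets (restrict_space borel ?X)"
    by (rule sets_restrict_space_cong) simp
  have space_lam: "space ?lam = ?X"
    by (simp add: space_restrict_space)
  have X: "?X \<in> sets ?lam"
    using sets.top[of ?lam] space_lam by simp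
  have emeasure_X: "emeasure ?lam ?X = 1"
    by (simp add: emeasure_restrict_space)
  obtain \<K> where max: "subset.maxchain (null_sets ?lam) \<K>"
    using subset.Hausdorff by blast
  then have chain: "subset.chain (null_sets ?lam) \<K>"
    by (rule subset.maxchain_imp_chain)
  have null: "K \<in> null_sets ?lam" if "K \<in> \<K>" for K
    using chain that by (auto simp: subset.chain_def)
  have not_null: "\<not> \<Union>\<K> \<subseteq> B" if "B \<in> null_sets ?lam" for B
  proof (rule maxchain_null_sets_union[OF max _ _ that])
    show "{x} \<in> null_sets ?lam" if "x \<in> space ?lam" for x
      using that by (simp add: null_sets_restrict_space space_lam finite_imp_null_set_lborel)
    show "space ?lam \<notin> null_sets ?lam"
      using emeasure_X by (simp add: space_lam null_sets_def)
  qed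
  have K_sub: "K \<subseteq> ?X" if "K \<in> \<K>" for K
    using null[OF that] sets.sets_into_space space_lam by blast
  obtain E where E: "E \<in> sets ?lam" "\<Union>\<K> \<subseteq> E" "outer_measure_of ?lam (\<Union>\<K>) = emeasure ?lam E"
    using outer_measure_of_attain[of "\<Union>\<K>" ?lam] K_sub space_lam by auto
  have E_pos: "emeasure ?lam E \<noteq> 0"
    using not_null[of E] E(1,2) by (auto simp: null_sets_def)
  have "emeasure ?lam E \<le> 1"
    using emeasure_mono[OF _ X, of E] sets.sets_into_space[OF E(1)] emeasure_X space_lam by simp
  then have E_fin: "emeasure ?lam E \<noteq> \<infinity>"
    by (auto simp: top_unique)
  let ?mu = "uniform_measure ?lam E"
  have mu: "borel_prob_measure ?X ?mu"
    using prob_space_uniform_measure[OF E_pos E_fin] sets_lam by (simp add: borel_prob_measure_def)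
  have "null_sets ?lam \<subseteq> null_sets ?mu"
  proof
    fix B assume B: "B \<in> null_sets ?lam"
    then have "emeasure ?lam (E \<inter> B) = 0"
      using null_set_Int1[OF B E(1)] by auto
    then show "B \<in> null_sets ?mu"
      using B E(1) by (auto simp: null_sets_def)
  qed
  then have chain_mu: "subset.chain (null_sets ?mu) \<K>"
    using chain by (auto simp: subset.chain_def)
  have not_PAC: "\<not> PAC_rule ?X (insert ?X \<K>) (prefer_rule \<K> ?X)"
    using outer_measure_of_uniform_measure_envelope[OF E E_pos E_fin]
    by (intro not_PAC_prefer_rule[OF mu chain_mu])
  have Borel: "borel_concept_class ?X (insert ?X \<K>)"
  proof -
    have "C \<in> sets ?lam" if "C \<in> insert ?X \<K>" for C
      using that null X by blast
    then show ?thesis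
      using K_sub by (auto simp only: borel_concept_class_def concept_class_def sets_lam)
  qed
  have VC: "VCdim ?X (insert ?X \<K>) = 1"
  proof -
    obtain K where K: "K \<in> \<K>"
      using not_null[of "{}"] by auto
    have "K \<noteq> ?X"
      using null[OF K] emeasure_X by (auto simp: null_sets_def)
    then obtain x where "x \<in> ?X" "x \<notin> K"
      using K_sub[OF K] by blast
    moreover have "H \<subseteq> H' \<or> H' \<subseteq> H" if "H \<in> insert ?X \<K>" "H' \<in> insert ?X \<K>" for H H'
      using that K_sub subset.chain_total[OF chain, of H H'] by (elim insertE) blast+
    ultimately show ?thesis
      using K by (intro VCdim_chain_eq_1[of _ ?X K x]) auto
  qed
  show ?thesis
    using Borel VC learning_rule_prefer_rule consistent_rule_prefer_rule not_PAC by blast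
qed

end
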